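(* Let $n \geqslant 0$. Then for $1 \leqslant \ell, k \leqslant n+1$ and $(a,b)\in[1]\times[n]$ we have: $$|T(n,k,\ell,(0,0))| = \sum_{k-1 \leqslant k' \leqslant n} |T(n-1,k',\ell-1)| \qquad (n\geqslant 1),$$ $$|T(n,k,\ell,(0,b))| = \sum_{0 \leqslant i \leqslant k} |\mathrm{Tam}(b-1,i)| \cdot |T(n-b,k-i,\ell,(0,0))| \qquad (0<b\leqslant n),$$ $$|T(n,k,\ell,(1,b))| = |T(n,\ell,k,(0,n-b))| \qquad (0\leqslant b\leqslant n).$$ Moreover, $$|T(n)| = \sum_{\substack{1 \leqslant k, \ell \leqslant n+1 \\ (a,b) \in [1] \times [n]}} |T(n,k,\ell,(a,b))|.$$
   Context: $[n]=\{0<1<\cdots<n\}$ and $[1]\times[n]$ has the product order; it is a lattice with maximum $(1,n)$. A transfer system on a lattice is a partial order $\mathcal{R}$ on its underlying set such that $x\,\mathcal{R}\,y$ implies $x\leqslant y$, and whenever $x\,\mathcal{R}\,y$ and $z\leqslant y$ we have $(x\wedge z)\,\mathcal{R}\,z$. $T(n)$ is the set of all transfer systems on $[1]\times[n]$. For a transfer system $\mathcal{R}$ on $[1]\times[n]$: an element $(1,b)$ is stationary if there are no $c,d$ with $d>b\geqslant c$ and $(1,c)\,\mathcal{R}\,(1,d)$; an element $(0,b)$ is extendable if $(0,b)\,\mathcal{R}\,(0,n)$ (elements $(0,b)$ are never stationary and elements $(1,b)$ are never extendable). An element $x$ is fibrant if $x\,\mathcal{R}\,(1,n)$; there is a unique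 minimal fibrant element. $T(n,k,\ell)$ is the set of $\mathcal{R}\in T(n)$ with exactly $k$ stationary elements and exactly $\ell$ extendable elements; $T(n,k,\ell,(a,b))$ is the set of $\mathcal{R}\in T(n,k,\ell)$ whose minimal fibrant element is $(a,b)$. By convention these have cardinality $0$ when $k$ or $\ell$ is out of the range $1,\dots,n+1$. $\mathrm{Tam}(n)$ is the set of all transfer systems $\mathcal{R}$ on $[1]\times[n]$ with $(0,n)\,\mathcal{R}\,(1,n)$, and $\mathrm{Tam}(n,k)$ is the set of those with exactly $k$ stationary elements. *)

theory Defs
  imports Main "HOL-Library.Product_Order"
begin

text \<open>The lattice is a carrier \<open>L\<close> inside a lattice type, meant to be closed under the ambient
  meet and join, so that its own meet is \<^const>\<open>inf\<close>.\<close>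

definition transfer_system_on :: "'a::lattice set \<Rightarrow> 'a rel \<Rightarrow> bool" where
  "transfer_system_on L R \<longleftrightarrow>
     partial_order_on L R \<and>
     (\<forall>x y. (x, y) \<in> R \<longrightarrow> x \<le> y) \<and>
     (\<forall>x y z. (x, y) \<in> R \<longrightarrow> z \<in> L \<longrightarrow> z \<le> y \<longrightarrow> (inf x z, z) \<in> R)"

text \<open>\<open>[1] \<times> [n]\<close> with the componentwise order and meet.\<close>

definition grid :: "nat \<Rightarrow> (nat \<times> nat) set" where
  "grid n = {0..1} \<times> {0..n}"

definition T :: "nat \<Rightarrow> (nat \<times> nat) rel set" where
  "T n = {R. transfer_system_on (grid n) R}"

definition stationary :: "(nat \<times> nat) rel \<Rightarrow> nat \<times> nat \<Rightarrow> bool" where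
  "stationary R x \<longleftrightarrow>
     fst x = 1 \<and> \<not> (\<exists>c d. d > snd x \<and> snd x \<ge> c \<and> ((1, c), (1, d)) \<in> R)"

definition extendable :: "nat \<Rightarrow> (nat \<times> nat) rel \<Rightarrow> nat \<times> nat \<Rightarrow> bool" where
  "extendable n R x \<longleftrightarrow> fst x = 0 \<and> (x, (0, n)) \<in> R"

definition fibrant :: "nat \<Rightarrow> (nat \<times> nat) rel \<Rightarrow> nat \<times> nat \<Rightarrow> bool" where
  "fibrant n R x \<longleftrightarrow> (x, (1, n)) \<in> R"

definition minimal_fibrant :: "nat \<Rightarrow> (nat \<times> nat) rel \<Rightarrow> nat \<times> nat \<Rightarrow> bool" where
  "minimal_fibrant n R x \<longleftrightarrow> fibrant n R x \<and> \<not> (\<exists>y. fibrant n R y \<and> y < x)"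

definition T_stat_ext :: "nat \<Rightarrow> nat \<Rightarrow> nat \<Rightarrow> (nat \<times> nat) rel set" where
  "T_stat_ext n k l =
     {R \<in> T n. card {x \<in> grid n. stationary R x} = k \<and> card {x \<in> grid n. extendable n R x} = l}"

definition T_stat_ext_fib ::
    "nat \<Rightarrow> nat \<Rightarrow> nat \<Rightarrow> nat \<times> nat \<Rightarrow> (nat \<times> nat) rel set" where
  "T_stat_ext_fib n k l x = {R \<in> T_stat_ext n k l. minimal_fibrant n R x}"

definition Tam :: "nat \<Rightarrow> (nat \<times> nat) rel set" where
  "Tam n = {R \<in> T n. ((0, n), (1, n)) \<in> R}"

definition Tam_stat :: "nat \<Rightarrow> nat \<Rightarrow> (nat \<times> nat) rel set" where
  "Tam_stat n k = {R \<in> Tam n. card {x \<in> grid n. stationary R x} = k}"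

text \<open>All these sets are finite, so \<^const>\<open>card\<close> is their true cardinality.\<close>

lemma T_subset: "R \<in> T n \<Longrightarrow> R \<subseteq> grid n \<times> grid n"
  by (auto simp: T_def transfer_system_on_def partial_order_on_def preorder_on_def)

lemma finite_T: "finite (T n)"
proof (rule finite_subset)
  show "T n \<subseteq> Pow (grid n \<times> grid n)"
    using T_subset by blast
  show "finite (Pow (grid n \<times> grid n))"
    by (simp add: grid_def)
qed

lemma refl_T: "R \<in> T n \<Longrightarrow> x \<in> grid n \<Longrightarrow> (x, x) \<in> R"
  by (auto simp: T_def transfer_system_on_def partial_order_on_def preorder_on_def refl_on_def)

text \<open>The minimal fibrant element exists and is unique.\<close>

lemma ex1_minimal_fibrant:
  assumes R: "R \<in> T n"
  shows "\<exists>!x. minimal_fibrant n R x"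
proof -
  have inf_fib: "fibrant n R (inf x y)" if x: "fibrant n R x" and y: "fibrant n R y" for x y
  proof -
    have "y \<in> grid n" using T_subset[OF R] y by (auto simp: fibrant_def)
    moreover have "y \<le> (1, n)"
      using R y unfolding T_def transfer_system_on_def fibrant_def by blast
    ultimately have "(inf x y, y) \<in> R"
      using R x unfolding T_def transfer_system_on_def fibrant_def by blast
    moreover have "trans R"
      using R by (auto simp: T_def transfer_system_on_def partial_order_on_def preorder_on_def)
    ultimately show ?thesis
      using y unfolding fibrant_def by (meson transD)
  qed
  have "finite {x. fibrant n R x}"
    by (rule finite_subset[of _ "grid n"]) (use T_subset[OF R] in \<open>auto simp: fibrant_def grid_def\<close>)
  moreover have "fibrant n R (1, n)"
    using refl_T[OF R] by (auto simp: fibrant_def grid_def)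
  ultimately obtain m where m: "fibrant n R m" "\<And>y. fibrant n R y \<Longrightarrow> y \<le> m \<Longrightarrow> m = y"
    using finite_has_minimal[of "{x. fibrant n R x}"] by blast
  show ?thesis
  proof (rule ex1I[of _ m])
    show "minimal_fibrant n R m"
      using m unfolding minimal_fibrant_def by (metis less_le)
    fix x assume x: "minimal_fibrant n R x"
    have "inf m x = x" 
      using inf_fib[OF m(1), of x] x unfolding minimal_fibrant_def
      by (meson inf.cobounded2 le_less)
    moreover have "inf m x = m"
      using inf_fib[OF m(1), of x] x m(2)[of "inf m x"] unfolding minimal_fibrant_def by simp
    ultimately show "x = m" by simp
  qed
qed

text \<open>The convention that the numbers vanish for indices outside \<open>1, \<dots>, n + 1\<close> is automatic:
  \<open>(1, n)\<close> is always stationary and \<open>(0, n)\<close> always extendable.\<close>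

lemma T_stat_ext_out_of_range:
  assumes "k \<notin> {1..n+1} \<or> l \<notin> {1..n+1}"
  shows "T_stat_ext n k l = {}"
proof -
  have "k \<in> {1..n+1} \<and> l \<in> {1..n+1}" if "R \<in> T_stat_ext n k l" for R
  proof -
    let ?S = "{x \<in> grid n. stationary R x}" and ?E = "{x \<in> grid n. extendable n R x}"
    have R: "R \<in> T n" and k: "k = card ?S" and l: "l = card ?E"
      using that by (auto simp: T_stat_ext_def)
    have fin: "finite ?S" "finite ?E" by (simp_all add: grid_def)
    have "snd y \<le> n" if "(x, y) \<in> R" for x y
      using T_subset[OF R] that by (auto simp: grid_def)
    then have "(1, n) \<in> ?S"
      by (auto simp: stationary_def grid_def) (metis leD snd_conv)
    moreover have "(0, n) \<in> ?E"
      using refl_T[OF R] by (auto simp: extendable_def grid_def)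
    ultimately have "0 < card ?S" "0 < card ?E"
      using fin card_gt_0_iff by blast+
    moreover have "card ?S \<le> card (Pair (1::nat) ` {0..n})"
      by (rule card_mono) (auto simp: stationary_def grid_def)
    moreover have "card ?E \<le> card (Pair (0::nat) ` {0..n})"
      by (rule card_mono) (auto simp: extendable_def grid_def)
    ultimately show ?thesis
      using card_image_le[of "{0..n}" "Pair (1::nat)"] card_image_le[of "{0..n}" "Pair (0::nat)"]
      by (simp add: k l)
  qed
  with assms show ?thesis by blast
qed

end

(* If (0,0) is fibrant, then R is a transfer system R' on the columns 1..n together with one number
   m: (1,0) is related to exactly the (1,j) with j <= m. Transitivity says that m = 0 or (1,m) is
   stationary in R'. The stationary columns of R are 0 and those of R', truncated below m, so each
   k between 1 and (number of stationary elements of R') + 1 comes from exactly one m.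

   If the minimal fibrant element is (0,b) with b > 0, no relation crosses between the columns below
   b and the others, and R splits into an element of Tam(b-1) and a transfer system in which the
   lowest corner is fibrant.

   A transfer system is the right class of a weak factorization system; reversing the left class
   along (a,i) |-> (1-a,n-i) is an involution on T(n) that exchanges the numbers of stationary and
   extendable elements. The factorization of (0,0) <= (1,n) passes through the minimal fibrant
   element, which is therefore mapped to the minimal fibrant element of the dual. *)

theory Submission
  imports Defs
begin

lemma grid_iff [simp]: "(a, b) \<in> grid n \<longleftrightarrow> a \<le> 1 \<and> b \<le> n"
  by (auto simp: grid_def)

lemma finite_grid [simp]: "finite (grid n)"
  by (simp add: grid_def)

section \<open>Transfer systems on the grid, pointwise and in coordinates\<close>

lemma T_I:
  assumes "\<And>x y. (x, y) \<in> R \<Longrightarrow> x \<in> grid n \<and> y \<in> grid n \<and> x \<le> y"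
    and "\<And>x. x \<in> grid n \<Longrightarrow> (x, x) \<in> R"
    and "\<And>x y z. (x, y) \<in> R \<Longrightarrow> (y, z) \<in> R \<Longrightarrow> (x, z) \<in> R"
    and "\<And>x y z. (x, y) \<in> R \<Longrightarrow> z \<in> grid n \<Longrightarrow> z \<le> y \<Longrightarrow> (inf x z, z) \<in> R"
  shows "R \<in> T n"
proof -
  have "antisym R"
    by (rule antisymI) (meson assms(1) order.antisym)
  moreover have "trans R"
    by (rule transI) (rule assms(3))
  moreover have "R \<subseteq> grid n \<times> grid n"
    using assms(1) by auto
  ultimately show ?thesis
    using assms unfolding T_def transfer_system_on_def partial_order_on_def preorder_on_def refl_on_def
    by blast
qed

lemma grid_T: "R \<in> T n \<Longrightarrow> (x, y) \<in> R \<Longrightarrow> x \<in> grid n \<and> y \<in> grid n"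
  using T_subset by blast

lemma le_T: "R \<in> T n \<Longrightarrow> (x, y) \<in> R \<Longrightarrow> x \<le> y"
  unfolding T_def transfer_system_on_def by blast

lemma trans_T: "R \<in> T n \<Longrightarrow> (x, y) \<in> R \<Longrightarrow> (y, z) \<in> R \<Longrightarrow> (x, z) \<in> R"
  unfolding T_def transfer_system_on_def partial_order_on_def preorder_on_def
  by (blast dest: transD)

lemma restrict_T: "R \<in> T n \<Longrightarrow> (x, y) \<in> R \<Longrightarrow> z \<in> grid n \<Longrightarrow> z \<le> y \<Longrightarrow> (inf x z, z) \<in> R"
  unfolding T_def transfer_system_on_def by blast

text \<open>Grid membership of \<open>(d, h)\<close> is inherited from \<open>(c, j)\<close>,
  because the grid is closed downwards. Most restrictions below use this coordinate form.\<close>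

lemma restrict_pair_T:
  assumes "R \<in> T n" "((a, i), (c, j)) \<in> R" "d \<le> c" "h \<le> j"
  shows "((min a d, min i h), (d, h)) \<in> R"
proof -
  have "(d, h) \<in> grid n"
    using grid_T[OF assms(1,2)] assms(3,4) by simp
  from restrict_T[OF assms(1,2) this] assms(3,4) show ?thesis
    by (simp add: inf_prod_def inf_nat_def)
qed

section \<open>Stationary and extendable elements recorded by their column\<close>

definition stat_cols :: "nat \<Rightarrow> (nat \<times> nat) rel \<Rightarrow> nat set" where
  "stat_cols n R = {b. b \<le> n \<and> \<not> (\<exists>c d. b < d \<and> c \<le> b \<and> ((1, c), (1, d)) \<in> R)}"

definition ext_cols :: "nat \<Rightarrow> (nat \<times> nat) rel \<Rightarrow> nat set" where
  "ext_cols n R = {b. b \<le> n \<and> ((0, b), (0, n)) \<in> R}"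

lemma finite_cols [simp]: "finite (stat_cols n R)" "finite (ext_cols n R)"
  by (auto simp: stat_cols_def ext_cols_def)

lemma card_stationary: "card {x \<in> grid n. stationary R x} = card (stat_cols n R)"
proof -
  have "{x \<in> grid n. stationary R x} = Pair 1 ` stat_cols n R"
    by (auto simp: stationary_def stat_cols_def)
  then show ?thesis
    by (simp add: card_image inj_on_def)
qed

lemma card_extendable: "card {x \<in> grid n. extendable n R x} = card (ext_cols n R)"
proof -
  have "{x \<in> grid n. extendable n R x} = Pair 0 ` ext_cols n R"
    by (auto simp: extendable_def ext_cols_def)
  then show ?thesis
    by (simp add: card_image inj_on_def)
qed

lemmas counting_defs = T_stat_ext_fib_def T_stat_ext_def Tam_stat_def Tam_def
  card_stationary card_extendable

text \<open>Nothing lies strictly below \<open>(0, 0)\<close>, so minimality is automatic.\<close>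

lemma minimal_fibrant_00: "minimal_fibrant n R (0, 0) \<longleftrightarrow> ((0, 0), (1, n)) \<in> R"
  by (auto simp: minimal_fibrant_def fibrant_def less_prod_def)

lemma minimal_fibrant_0:
  "minimal_fibrant n R (0, b) \<longleftrightarrow> ((0, b), (1, n)) \<in> R \<and> (\<forall>c<b. ((0, c), (1, n)) \<notin> R)"
proof -
  have "y < (0, b) \<longleftrightarrow> (\<exists>c<b. y = (0, c))" for y :: "nat \<times> nat"
    by (cases y) (auto simp: less_prod_def)
  then show ?thesis
    by (auto simp: minimal_fibrant_def fibrant_def)
qed

section \<open>Shifting along the second coordinate\<close>

definition shift :: "nat \<Rightarrow> nat \<times> nat \<Rightarrow> nat \<times> nat" where
  "shift b x = (fst x, snd x + b)"

definition shift_rel :: "nat \<Rightarrow> (nat \<times> nat) rel \<Rightarrow> (nat \<times> nat) rel" where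
  "shift_rel b R = map_prod (shift b) (shift b) ` R"

text \<open>A preimage instead of an image: it also forgets every pair that meets a column below
  \<open>b\<close>. It is therefore a left inverse of \<open>shift_rel b\<close>, but not a right
  inverse.\<close>

definition unshift_rel :: "nat \<Rightarrow> (nat \<times> nat) rel \<Rightarrow> (nat \<times> nat) rel" where
  "unshift_rel b R = {(x, y). (shift b x, shift b y) \<in> R}"

text \<open>The guards \<open>b \<le> i\<close> and \<open>b \<le> j\<close> exclude truncated
  subtraction, which would identify all columns up to \<open>b\<close>.\<close>

lemma shift_rel_iff:
  "((a, i), (c, j)) \<in> shift_rel b R \<longleftrightarrow> b \<le> i \<and> b \<le> j \<and> ((a, i - b), (c, j - b)) \<in> R"
proof -
  have "((a, i), (c, j)) = map_prod (shift b) (shift b) ((a, i - b), (c, j - b))"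
    if "b \<le> i" "b \<le> j"
    using that by (simp add: shift_def)
  then show ?thesis
    unfolding shift_rel_def by (force simp: shift_def)
qed

lemma unshift_rel_iff:
  "((a, i), (c, j)) \<in> unshift_rel b R \<longleftrightarrow> ((a, i + b), (c, j + b)) \<in> R"
  by (simp add: unshift_rel_def shift_def)

text \<open>The columns from \<open>b\<close> to \<open>n\<close> form a sublattice isomorphic to
  \<open>grid (n - b)\<close>, and the axioms pass to sublattices.\<close>

lemma unshift_rel_T:
  assumes R: "R \<in> T n" and b: "b \<le> n"
  shows "unshift_rel b R \<in> T (n - b)"
proof (rule T_I)
  fix x y z :: "nat \<times> nat"
  show "x \<in> grid (n - b) \<and> y \<in> grid (n - b) \<and> x \<le> y" if "(x, y) \<in> unshift_rel b R"
    using that grid_T[OF R] le_T[OF R] by (cases x; cases y) (fastforce simp: unshift_rel_iff)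
  show "(x, x) \<in> unshift_rel b R" if "x \<in> grid (n - b)"
    using that b refl_T[OF R] by (cases x) (auto simp: unshift_rel_iff)
  show "(x, z) \<in> unshift_rel b R" if "(x, y) \<in> unshift_rel b R" "(y, z) \<in> unshift_rel b R"
    using that trans_T[OF R] by (cases x; cases y; cases z) (auto simp: unshift_rel_iff)
  show "(inf x z, z) \<in> unshift_rel b R" if "(x, y) \<in> unshift_rel b R" "z \<le> y"
    using that restrict_pair_T[OF R]
    by (cases x; cases y; cases z) (fastforce simp: unshift_rel_iff inf_prod_def inf_nat_def min_add_distrib_left)
qed

section \<open>Minimal fibrant element $(0,0)$\<close>

text \<open>The first block is what restriction makes of \<open>((0, 0), (1, n))\<close>. The pairs
  leaving \<open>(1, 0)\<close> form an initial segment of row 1, recorded by its last column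
  \<open>m\<close>.\<close>

definition cone :: "nat \<Rightarrow> nat \<Rightarrow> (nat \<times> nat) rel \<Rightarrow> (nat \<times> nat) rel" where
  "cone n m R = {(0, 0)} \<times> grid n \<union> {((1, 0), (1, j)) | j. j \<le> m} \<union> shift_rel 1 R"

lemma cone_iff:
  "((a, i), (c, j)) \<in> cone n m R \<longleftrightarrow>
     a = 0 \<and> i = 0 \<and> c \<le> 1 \<and> j \<le> n \<or>
     a = 1 \<and> i = 0 \<and> c = 1 \<and> j \<le> m \<or>
     1 \<le> i \<and> 1 \<le> j \<and> ((a, i - 1), (c, j - 1)) \<in> R"
  by (auto simp: cone_def shift_rel_iff)

text \<open>The values of \<open>m\<close> that transitivity allows. The same set, cut off below
  \<open>m\<close>, reappears as the stationary columns of the cone.\<close>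

definition cone_cols :: "nat \<Rightarrow> (nat \<times> nat) rel \<Rightarrow> nat set" where
  "cone_cols n R = insert 0 (Suc ` stat_cols (n - 1) R)"

text \<open>One criterion covers both kinds of members: for \<open>m = 0\<close> it holds vacuously,
  as no \<open>c\<close> satisfies \<open>1 \<le> c \<le> m\<close>.\<close>

lemma cone_cols_iff:
  assumes "n \<ge> 1"
  shows "m \<in> cone_cols n R \<longleftrightarrow>
    m \<le> n \<and> (\<forall>c d. 1 \<le> c \<longrightarrow> c \<le> m \<longrightarrow> m < d \<longrightarrow> ((1, c - 1), (1, d - 1)) \<notin> R)"
proof (cases m)
  case (Suc m')
  have *: "(\<exists>c d. m' < d \<and> c \<le> m' \<and> ((1, c), (1, d)) \<in> R) \<longleftrightarrow>
        (\<exists>c d. 1 \<le> c \<and> c \<le> m \<and> m < d \<and> ((1, c - 1), (1, d - 1)) \<in> R)" (is "?l \<longleftrightarrow> ?r")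
  proof
    assume ?l
    then obtain c d where "m' < d" "c \<le> m'" "((1, c), (1, d)) \<in> R" by blast
    with Suc show ?r by (intro exI[of _ "Suc c"] exI[of _ "Suc d"]) auto
  next
    assume ?r
    then obtain c d where "1 \<le> c" "c \<le> m" "m < d" "((1, c - 1), (1, d - 1)) \<in> R" by blast
    with Suc show ?l by (intro exI[of _ "c - 1"] exI[of _ "d - 1"]) auto
  qed
  have "m \<in> cone_cols n R \<longleftrightarrow> m' \<in> stat_cols (n - 1) R"
    by (auto simp: cone_cols_def Suc)
  also have "\<dots> \<longleftrightarrow> m' \<le> n - 1 \<and> \<not> (\<exists>c d. m' < d \<and> c \<le> m' \<and> ((1, c), (1, d)) \<in> R)"
    by (simp add: stat_cols_def)
  finally show ?thesis
    using assms unfolding * by (auto simp: Suc)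
qed (auto simp: cone_cols_def)

lemma finite_cone_cols [simp]: "finite (cone_cols n R)"
  by (simp add: cone_cols_def)

lemma card_cone_cols: "card (cone_cols n R) = Suc (card (stat_cols (n - 1) R))"
  unfolding cone_cols_def by (subst card_insert_disjoint) (auto simp: card_image)

lemma cone_T:
  assumes R: "R \<in> T (n - 1)" and n: "n \<ge> 1" and m: "m \<in> cone_cols n R"
  shows "cone n m R \<in> T n"
proof (rule T_I)
  have m_le: "m \<le> n"
    and m_stat: "\<And>c d. 1 \<le> c \<Longrightarrow> c \<le> m \<Longrightarrow> m < d \<Longrightarrow> ((1, c - 1), (1, d - 1)) \<notin> R"
    using m unfolding cone_cols_iff[OF n] by blast+
  fix x y z :: "nat \<times> nat"
  obtain a i c j e h where [simp]: "x = (a, i)" "y = (c, j)" "z = (e, h)"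
    by (cases x; cases y; cases z) auto
  have R_D: "a \<le> c \<and> i \<le> j \<and> c \<le> 1 \<and> j \<le> n - 1" if "((a, i), (c, j)) \<in> R" for a i c j
    using grid_T[OF R that] le_T[OF R that] by auto
  show "x \<in> grid n \<and> y \<in> grid n \<and> x \<le> y" if "(x, y) \<in> cone n m R"
    using that n m_le by (auto simp: cone_iff dest!: R_D)
  show "(x, x) \<in> cone n m R" if "x \<in> grid n"
    using that n refl_T[OF R, of "(a, i - 1)"] by (cases i) (auto simp: cone_iff le_Suc_eq)
  show "(x, z) \<in> cone n m R" if xy: "(x, y) \<in> cone n m R" and yz: "(y, z) \<in> cone n m R"
  proof -
    have z: "e \<le> 1 \<and> h \<le> n"
      using yz n m_le by (auto simp: cone_iff dest!: R_D)
    consider "a = 0 \<and> i = 0" | "a = 1 \<and> i = 0 \<and> c = 1 \<and> j \<le> m"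
      | "1 \<le> i \<and> 1 \<le> j \<and> ((a, i - 1), (c, j - 1)) \<in> R"
      using xy by (auto simp: cone_iff)
    then show ?thesis
    proof cases
      case 1
      with z show ?thesis by (simp add: cone_iff)
    next
      case 2
      \<comment> \<open>If \<open>j = 0\<close>, the second pair starts at \<open>(1, 0)\<close>
        again and ends by column \<open>m\<close>. If \<open>j \<ge> 1\<close>, it comes from
        \<open>R\<close>, and the condition on \<open>m\<close> keeps it from passing column
        \<open>m\<close>.\<close>
      then have "e = 1 \<and> h \<le> m"
        using yz m_stat[of j h] R_D[of c "j - 1" e "h - 1"]
        by (auto simp: cone_iff) (metis One_nat_def le_antisym not_le)+
      with 2 show ?thesis by (simp add: cone_iff)
    next
      case 3
      then have "1 \<le> h \<and> ((c, j - 1), (e, h - 1)) \<in> R"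
        using yz by (auto simp: cone_iff)
      with 3 trans_T[OF R] show ?thesis by (auto simp: cone_iff)
    qed
  qed
  show "(inf x z, z) \<in> cone n m R" if xy: "(x, y) \<in> cone n m R" and z: "z \<in> grid n" "z \<le> y"
  proof -
    consider "a = 0 \<and> i = 0" | "a = 1 \<and> i = 0 \<and> c = 1 \<and> j \<le> m"
      | "1 \<le> i \<and> 1 \<le> j \<and> ((a, i - 1), (c, j - 1)) \<in> R"
      using xy by (auto simp: cone_iff)
    then show ?thesis
    proof cases
      case 3
      show ?thesis
      proof (cases h)
        case 0
        \<comment> \<open>In column 0 the restricted pair starts at \<open>(0, 0)\<close> or is the
          identity at \<open>(1, 0)\<close>.\<close>
        with 3 z show ?thesis
          by (auto simp: cone_iff inf_prod_def inf_nat_def min_def le_Suc_eq)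
      next
        case (Suc h')
        then have "((min a e, min (i - 1) h'), (e, h')) \<in> R"
          using restrict_pair_T[OF R, of a "i - 1" c "j - 1" e h'] 3 z by auto
        moreover have "min (i - 1) h' = min i h - 1"
          using 3 Suc by auto
        ultimately show ?thesis
          using 3 Suc by (simp add: cone_iff inf_prod_def inf_nat_def)
      qed
    qed (use z in \<open>auto simp: cone_iff inf_prod_def inf_nat_def min_def\<close>)
  qed
qed

lemma unshift_cone: "R \<in> T (n - 1) \<Longrightarrow> unshift_rel 1 (cone n m R) = R"
  by (auto simp: unshift_rel_iff cone_iff)

text \<open>A column fails to be stationary either because of the pair from \<open>(1, 0)\<close> to
  \<open>(1, m)\<close>, which spoils exactly the columns below \<open>m\<close>, or because of a
  shifted pair of \<open>R\<close>.\<close>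

lemma stat_cols_cone:
  assumes R: "R \<in> T (n - 1)" and n: "n \<ge> 1" and m: "m \<in> cone_cols n R"
  shows "stat_cols n (cone n m R) = {b \<in> cone_cols n R. m \<le> b}"
proof -
  have "m \<le> n"
    using m by (auto simp: cone_cols_iff[OF n])
  moreover have "(\<exists>c d. b < d \<and> c \<le> b \<and> ((1, c), (1, d)) \<in> cone n m R) \<longleftrightarrow>
     b < m \<or> (\<exists>c d. 1 \<le> c \<and> c \<le> b \<and> b < d \<and> ((1, c - 1), (1, d - 1)) \<in> R)"
    (is "?l \<longleftrightarrow> ?r") for b
  proof
    assume ?r
    then show ?l
    proof (elim disjE exE)
      assume "b < m"
      then show ?l by (intro exI[of _ 0] exI[of _ m]) (simp add: cone_iff)
    next
      fix c d assume "1 \<le> c \<and> c \<le> b \<and> b < d \<and> ((1, c - 1), (1, d - 1)) \<in> R"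
      then show ?l by (intro exI[of _ c] exI[of _ d]) (simp add: cone_iff)
    qed
  qed (auto simp: cone_iff)
  ultimately show ?thesis
    unfolding stat_cols_def by (simp add: set_eq_iff cone_cols_iff[OF n] not_less del: One_nat_def) (meson not_less order_trans)
qed

text \<open>Column 0 is a new extendable column, since \<open>(0, 0)\<close> is related to
  everything; the others are shifted from \<open>R\<close>.\<close>

lemma ext_cols_cone:
  assumes R: "R \<in> T (n - 1)" and n: "n \<ge> 1"
  shows "card (ext_cols n (cone n m R)) = Suc (card (ext_cols (n - 1) R))"
proof -
  have "b \<in> ext_cols n (cone n m R) \<longleftrightarrow> b \<in> insert 0 (Suc ` ext_cols (n - 1) R)" for b
    using n by (cases b) (auto simp: ext_cols_def cone_iff)
  then have "ext_cols n (cone n m R) = insert 0 (Suc ` ext_cols (n - 1) R)"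
    by blast
  then show ?thesis
    by (simp add: card_image)
qed

lemma eq_cone:
  assumes R: "R \<in> T n" and n: "n \<ge> 1" and fib: "((0, 0), (1, n)) \<in> R"
  obtains m where "m \<in> cone_cols n (unshift_rel 1 R)" "R = cone n m (unshift_rel 1 R)"
proof -
  define M where "M = {j. ((1, 0), (1, j)) \<in> R}"
  have "M \<subseteq> {..n}"
    using grid_T[OF R] by (auto simp: M_def)
  then have fin: "finite M"
    by (rule finite_subset) simp
  have "((1, 0), (1, 0)) \<in> R"
    by (rule refl_T[OF R]) simp
  then have "0 \<in> M" by (simp add: M_def)
  \<comment> \<open>By restriction \<open>M\<close> is an initial segment, so its maximum determines
    it.\<close>
  define m where "m = Max M"
  have "m \<in> M"
    using fin \<open>0 \<in> M\<close> unfolding m_def by (intro Max_in) auto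
  then have m: "((1, 0), (1, m)) \<in> R" by (simp add: M_def)
  have m_iff: "((1, 0), (1, j)) \<in> R \<longleftrightarrow> j \<le> m" for j
  proof
    show "j \<le> m" if "((1, 0), (1, j)) \<in> R"
      using that fin unfolding m_def by (intro Max_ge) (auto simp: M_def)
    show "((1, 0), (1, j)) \<in> R" if "j \<le> m"
      using restrict_pair_T[OF R m, of 1 j] that by simp
  qed
  have R_D: "a \<le> c \<and> i \<le> j \<and> c \<le> 1 \<and> j \<le> n" if "((a, i), (c, j)) \<in> R" for a i c j
    using grid_T[OF R that] le_T[OF R that] by auto
  have zero: "((0, 0), (c, j)) \<in> R" if "c \<le> 1" "j \<le> n" for c j
    using restrict_pair_T[OF R fib that] by simp
  \<comment> \<open>Otherwise transitivity would carry \<open>(1, 0)\<close> through column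
    \<open>c\<close> to column \<open>d\<close>, beyond the maximum \<open>m\<close>.\<close>
  have "((1, c), (1, d)) \<notin> R" if "c \<le> m" "m < d" for c d
    using that m_iff trans_T[OF R] by (metis not_less)
  then have "m \<in> cone_cols n (unshift_rel 1 R)"
    using R_D[OF m] by (auto simp: cone_cols_iff[OF n] unshift_rel_iff)
  moreover have "((a, i), (c, j)) \<in> R \<longleftrightarrow> ((a, i), (c, j)) \<in> cone n m (unshift_rel 1 R)" for a i c j
  proof (cases i)
    case 0
    show ?thesis
    proof (cases "a = 0")
      case True
      with 0 show ?thesis using zero R_D by (auto simp: cone_iff)
    next
      case False
      have "a = 1 \<and> c = 1" if "((a, 0), (c, j)) \<in> R"
        using R_D[OF that] False by arith
      then have "((a, 0), (c, j)) \<in> R \<longleftrightarrow> a = 1 \<and> c = 1 \<and> j \<le> m"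
        using m_iff by metis
      with 0 False show ?thesis by (simp add: cone_iff)
    qed
  next
    case (Suc i')
    show ?thesis
    proof (cases j)
      case 0
      with Suc have "((a, i), (c, j)) \<notin> R" using R_D[of a i c j] by auto
      with Suc 0 show ?thesis by (simp add: cone_iff)
    qed (use Suc in \<open>simp add: cone_iff unshift_rel_iff\<close>)
  qed
  then have "R = cone n m (unshift_rel 1 R)"
    by auto
  ultimately show thesis by (rule that)
qed

text \<open>The upper segment shrinks strictly as its starting point moves up through
  \<open>S\<close>, since the old starting point is lost. Hence the number of stationary columns of
  a cone determines \<open>m\<close>.\<close>

lemma card_upper_inj:
  fixes S :: "nat set"
  assumes "finite S" "m \<in> S" "m' \<in> S" "card {b \<in> S. m \<le> b} = card {b \<in> S. m' \<le> b}"
  shows "m = m'"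
proof -
  have *: "card {b \<in> S. q \<le> b} < card {b \<in> S. p \<le> b}" if "p < q" "p \<in> S" for p q
  proof (rule psubset_card_mono)
    have "p \<in> {b \<in> S. p \<le> b}" "p \<notin> {b \<in> S. q \<le> b}"
      using that by auto
    moreover have "{b \<in> S. q \<le> b} \<subseteq> {b \<in> S. p \<le> b}"
      using that by auto
    ultimately show "{b \<in> S. q \<le> b} \<subset> {b \<in> S. p \<le> b}"
      by blast
  qed (use \<open>finite S\<close> in simp)
  show ?thesis
    using *[of m m'] *[of m' m] assms by (cases m m' rule: linorder_cases) auto
qed

text \<open>An injective map from \<open>S\<close> into \<open>{1..card S}\<close> is onto, by
  counting.\<close>

lemma card_upper_surj:
  fixes S :: "nat set"
  assumes S: "finite S" and k: "1 \<le> k" "k \<le> card S"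
  obtains m where "m \<in> S" "card {b \<in> S. m \<le> b} = k"
proof -
  let ?f = "\<lambda>m. card {b \<in> S. m \<le> b}"
  have "inj_on ?f S"
    using card_upper_inj[OF S] by (auto simp: inj_on_def)
  moreover have "?f ` S \<subseteq> {1..card S}"
  proof clarsimp
    fix m assume "m \<in> S"
    then have "?f m > 0" using S by (auto simp: card_gt_0_iff)
    with S show "Suc 0 \<le> ?f m \<and> ?f m \<le> card S" by (auto intro: card_mono)
  qed
  ultimately have "?f ` S = {1..card S}"
    by (intro card_subset_eq) (auto simp: card_image)
  with k show thesis
    using that by (metis (no_types, lifting) atLeastAtMost_iff imageE)
qed

text \<open>Deleting column 0 is the bijection. Once \<open>k\<close> is fixed, the truncation point
  is determined by what remains, and it exists exactly when \<open>k - 1\<close> is at most the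
  number \<open>k'\<close> of stationary elements that remain. Column 0 accounts for the one lost
  extendable element.\<close>

lemma card_fib_00:
  assumes n: "n \<ge> 1" and k: "k \<ge> 1" and l: "l \<ge> 1"
  shows "card (T_stat_ext_fib n k l (0, 0)) = (\<Sum>k' = k-1..n. card (T_stat_ext (n-1) k' (l-1)))"
proof -
  let ?A = "T_stat_ext_fib n k l (0, 0)"
  let ?B = "\<Union>k'\<in>{k-1..n}. T_stat_ext (n-1) k' (l-1)"
  have B: "R \<in> ?B \<longleftrightarrow> R \<in> T (n-1) \<and> k \<le> card (cone_cols n R) \<and> card (ext_cols (n-1) R) = l - 1" for R
  proof -
    \<comment> \<open>There are only \<open>n\<close> columns left, so the upper bound
      \<open>n\<close> on \<open>k'\<close> excludes nothing.\<close>
    have "card (stat_cols (n-1) R) \<le> n"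
      using card_mono[of "{..n-1}" "stat_cols (n-1) R"] n by (auto simp: stat_cols_def)
    then show ?thesis
      by (auto simp: counting_defs card_cone_cols)
  qed
  have A: "R \<in> ?A \<longleftrightarrow> R \<in> T n \<and> card (stat_cols n R) = k \<and> card (ext_cols n R) = l
      \<and> ((0, 0), (1, n)) \<in> R" for R
    by (auto simp: counting_defs minimal_fibrant_00)
  have "bij_betw (unshift_rel 1) ?A ?B"
    unfolding bij_betw_def
  proof (intro conjI equalityI subsetI)
    show "inj_on (unshift_rel 1) ?A"
    proof (rule inj_onI)
      fix R R' assume R: "R \<in> ?A" and R': "R' \<in> ?A" and eq: "unshift_rel 1 R = unshift_rel 1 R'"
      let ?U = "unshift_rel 1 R"
      have U: "?U \<in> T (n-1)" using R unshift_rel_T n A by blast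
      obtain m where m: "m \<in> cone_cols n ?U" "R = cone n m ?U"
        using eq_cone[OF _ n] R A by metis
      obtain m' where m': "m' \<in> cone_cols n ?U" "R' = cone n m' ?U"
        using eq_cone[OF _ n] R' A eq by metis
      \<comment> \<open>Both counts equal \<open>k\<close>, and the count determines the truncation
        point.\<close>
      have "card (stat_cols n (cone n m ?U)) = card (stat_cols n (cone n m' ?U))"
        using R R' A m(2) m'(2) by metis
      then have "m = m'"
        using card_upper_inj[OF _ m(1) m'(1)] stat_cols_cone[OF U n m(1)] stat_cols_cone[OF U n m'(1)]
        by simp
      with m m' show "R = R'" by simp
    qed
  next
    fix U assume "U \<in> unshift_rel 1 ` ?A"
    then obtain R where R: "R \<in> ?A" and U_eq: "U = unshift_rel 1 R" by blast
    have U: "U \<in> T (n-1)" using R unshift_rel_T n A U_eq by blast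
    obtain m where m: "m \<in> cone_cols n U" "R = cone n m U"
      using eq_cone[OF _ n] R A U_eq by metis
    have "card {b \<in> cone_cols n U. m \<le> b} = k"
      using R A m stat_cols_cone[OF U n m(1)] by metis
    then have "k \<le> card (cone_cols n U)"
      by (metis (no_types, lifting) card_mono finite_cone_cols mem_Collect_eq subsetI)
    moreover have "card (ext_cols (n-1) U) = l - 1"
      using R A m ext_cols_cone[OF U n] by (metis diff_Suc_1)
    ultimately show "U \<in> ?B" using U B by blast
  next
    fix U assume "U \<in> ?B"
    then have U: "U \<in> T (n-1)" and kU: "k \<le> card (cone_cols n U)" and lU: "card (ext_cols (n-1) U) = l - 1"
      using B by blast+
    \<comment> \<open>The bound on \<open>k\<close> is exactly what allows a truncation that leaves
      \<open>k\<close> columns.\<close>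
    obtain m where m: "m \<in> cone_cols n U" "card {b \<in> cone_cols n U. m \<le> b} = k"
      using card_upper_surj[OF finite_cone_cols k kU] .
    have "cone n m U \<in> ?A"
      using cone_T[OF U n m(1)] m(2) stat_cols_cone[OF U n m(1)] ext_cols_cone[OF U n] lU l
      unfolding A by (simp add: cone_iff)
    then show "U \<in> unshift_rel 1 ` ?A"
      using unshift_cone[OF U] by (metis image_eqI)
  qed
  then have "card ?A = card ?B"
    by (rule bij_betw_same_card)
  also have "\<dots> = (\<Sum>k' = k-1..n. card (T_stat_ext (n-1) k' (l-1)))"
    by (rule card_UN_disjoint) (auto simp: T_stat_ext_def finite_T)
  finally show ?thesis .
qed

section \<open>Minimal fibrant element $(0,b)$ with $b > 0$\<close>

definition glue :: "nat \<Rightarrow> (nat \<times> nat) rel \<Rightarrow> (nat \<times> nat) rel \<Rightarrow> (nat \<times> nat) rel" where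
  "glue b L U = L \<union> shift_rel b U"

lemma glue_iff:
  "((a, i), (c, j)) \<in> glue b L U \<longleftrightarrow>
     ((a, i), (c, j)) \<in> L \<or> b \<le> i \<and> b \<le> j \<and> ((a, i - b), (c, j - b)) \<in> U"
  by (simp add: glue_def shift_rel_iff)

text \<open>Restricting the pair from \<open>(0, m)\<close> to \<open>(1, m)\<close> gives the
  vertical pair in every column; the remaining cases are identities.\<close>

lemma Tam_column:
  assumes "L \<in> Tam m" "a \<le> e" "e \<le> 1" "h \<le> m"
  shows "((a, h), (e, h)) \<in> L"
proof -
  have L: "L \<in> T m" "((0, m), (1, m)) \<in> L"
    using assms(1) by (auto simp: Tam_def)
  have "((0, h), (1, h)) \<in> L"
    using restrict_pair_T[OF L, of 1 h] assms by (simp add: min_def split: if_splits)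
  moreover have "((a, h), (a, h)) \<in> L"
    using assms by (intro refl_T[OF L(1)]) simp
  ultimately show ?thesis
    using assms by (cases "a = e") (auto simp: le_Suc_eq)
qed

text \<open>The parts interact only when a pair of \<open>U\<close> is restricted to a column below
  \<open>b\<close>; membership of \<open>L\<close> in \<open>Tam (b - 1)\<close> supplies the
  resulting pair.\<close>

lemma glue_T:
  assumes b: "0 < b" "b \<le> n" and L: "L \<in> Tam (b - 1)" and U: "U \<in> T (n - b)"
  shows "glue b L U \<in> T n"
proof (rule T_I)
  have LT: "L \<in> T (b - 1)"
    using L by (simp add: Tam_def)
  fix x y z :: "nat \<times> nat"
  obtain a i c j e h where [simp]: "x = (a, i)" "y = (c, j)" "z = (e, h)"
    by (cases x; cases y; cases z) auto
  have L_D: "a \<le> c \<and> i \<le> j \<and> c \<le> 1 \<and> j < b" if "((a, i), (c, j)) \<in> L" for a i c j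
    using grid_T[OF LT that] le_T[OF LT that] b by auto
  have U_D: "a \<le> c \<and> i \<le> j \<and> c \<le> 1 \<and> j \<le> n - b" if "((a, i), (c, j)) \<in> U" for a i c j
    using grid_T[OF U that] le_T[OF U that] by auto
  show "x \<in> grid n \<and> y \<in> grid n \<and> x \<le> y" if "(x, y) \<in> glue b L U"
    using that b by (auto simp: glue_iff dest!: L_D U_D)
  show "(x, x) \<in> glue b L U" if "x \<in> grid n"
  proof (cases "b \<le> i")
    case True
    with that have "((a, i - b), (a, i - b)) \<in> U"
      by (intro refl_T[OF U]) auto
    with True show ?thesis by (simp add: glue_iff)
  next
    case False
    with that have "(x, x) \<in> L"
      by (intro refl_T[OF LT]) auto
    then show ?thesis by (simp add: glue_iff)
  qed
  show "(x, z) \<in> glue b L U" if xy: "(x, y) \<in> glue b L U" and yz: "(y, z) \<in> glue b L U"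
  \<comment> \<open>No pair crosses column \<open>b\<close>, so the middle point decides from which
    part both pairs come.\<close>
  proof (cases "j < b")
    case True
    with xy yz have "(x, y) \<in> L" "(y, z) \<in> L" by (auto simp: glue_iff)
    with trans_T[OF LT] show ?thesis by (auto simp: glue_def)
  next
    case False
    with xy have "b \<le> i" "((a, i - b), (c, j - b)) \<in> U"
      by (auto simp: glue_iff dest: L_D)
    moreover have "b \<le> h" "((c, j - b), (e, h - b)) \<in> U"
      using yz False by (auto simp: glue_iff dest: L_D)
    ultimately show ?thesis
      using trans_T[OF U] by (auto simp: glue_iff)
  qed
  show "(inf x z, z) \<in> glue b L U" if xy: "(x, y) \<in> glue b L U" and z: "z \<in> grid n" "z \<le> y"
  proof (cases "(x, y) \<in> L")
    case True
    have "(min a e, min i h) = inf x z"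
      by (simp add: inf_prod_def inf_nat_def)
    with restrict_pair_T[OF LT, of a i c j e h] True z show ?thesis
      by (auto simp: glue_def)
  next
    case False
    with xy have *: "b \<le> i" "b \<le> j" "((a, i - b), (c, j - b)) \<in> U"
      by (auto simp: glue_iff)
    show ?thesis
    proof (cases "h < b")
      case True
      \<comment> \<open>As \<open>h < b \<le> i\<close>, the meet stays in column \<open>h\<close>,
        so the restricted pair is vertical or an identity.\<close>
      with * z have "((min a e, h), (e, h)) \<in> L"
        by (intro Tam_column[OF L]) auto
      with True * show ?thesis
        by (simp add: glue_iff inf_prod_def inf_nat_def min_def)
    next
      case False
      then have "((min a e, min (i - b) (h - b)), (e, h - b)) \<in> U"
        using restrict_pair_T[OF U *(3), of e "h - b"] z diff_le_mono[of h j b] by simp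
      moreover have "min (i - b) (h - b) = min i h - b"
        by auto
      ultimately show ?thesis
        using False * by (simp add: glue_iff inf_prod_def inf_nat_def)
    qed
  qed
qed

text \<open>The columns below \<open>b\<close> are a sublattice, and restricting
  \<open>((0, b), (1, n))\<close> to \<open>(1, b - 1)\<close> gives the pair that defines
  \<open>Tam (b - 1)\<close>.\<close>

lemma lower_Tam:
  assumes R: "R \<in> T n" and b: "0 < b" "b \<le> n" and fib: "((0, b), (1, n)) \<in> R"
  shows "R \<inter> grid (b - 1) \<times> grid (b - 1) \<in> Tam (b - 1)"
proof -
  let ?L = "R \<inter> grid (b - 1) \<times> grid (b - 1)"
  have "?L \<in> T (b - 1)"
  proof (rule T_I)
    fix x y z :: "nat \<times> nat"
    show "x \<in> grid (b - 1) \<and> y \<in> grid (b - 1) \<and> x \<le> y" if "(x, y) \<in> ?L"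
      using that le_T[OF R] by auto
    show "(x, x) \<in> ?L" if "x \<in> grid (b - 1)"
      using that refl_T[OF R, of x] b by (cases x) auto
    show "(x, z) \<in> ?L" if "(x, y) \<in> ?L" "(y, z) \<in> ?L"
      using that trans_T[OF R, of x y z] by auto
    show "(inf x z, z) \<in> ?L" if "(x, y) \<in> ?L" "z \<in> grid (b - 1)" "z \<le> y"
      using that restrict_T[OF R, of x y z] b
      by (cases x; cases z) (auto simp: inf_prod_def inf_nat_def)
  qed
  moreover have "((0, b - 1), (1, b - 1)) \<in> R"
    using restrict_pair_T[OF R fib, of 1 "b - 1"] b by (cases b) (simp_all add: min_def)
  ultimately show ?thesis
    by (simp add: Tam_def)
qed

lemma eq_glue:
  assumes R: "R \<in> T n" and b: "0 < b" "b \<le> n" and fib: "minimal_fibrant n R (0, b)"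
  shows "R = glue b (R \<inter> grid (b - 1) \<times> grid (b - 1)) (unshift_rel b R)"
proof -
  have bn: "((0, b), (1, n)) \<in> R" and nfib: "\<And>c. c < b \<Longrightarrow> ((0, c), (1, n)) \<notin> R"
    using fib by (auto simp: minimal_fibrant_0)
  \<comment> \<open>Restricting a crossing pair to \<open>(0, b)\<close> relates
    \<open>(0, i)\<close> to \<open>(0, b)\<close>. Then \<open>(0, i)\<close> is fibrant, against
    minimality.\<close>
  have no_cross: "((a, i), (c, j)) \<notin> R" if "i < b" "b \<le> j" for a i c j
  proof
    assume "((a, i), (c, j)) \<in> R"
    from restrict_pair_T[OF R this, of 0 b] that have "((0, i), (0, b)) \<in> R"
      by simp
    with bn nfib that trans_T[OF R] show False by blast
  qed
  have "((a, i), (c, j)) \<in> R \<longleftrightarrow>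
      ((a, i), (c, j)) \<in> glue b (R \<inter> grid (b - 1) \<times> grid (b - 1)) (unshift_rel b R)" for a i c j
    using grid_T[OF R, of "(a, i)" "(c, j)"] le_T[OF R, of "(a, i)" "(c, j)"] no_cross[of i j a c] b
    by (cases "i < b"; cases "j < b") (auto simp: glue_iff unshift_rel_iff)
  then show ?thesis by auto
qed

text \<open>The parts occupy disjoint sets of columns, so both can be read off again; this makes
  gluing injective.\<close>

lemma glue_parts:
  assumes b: "0 < b" and L: "L \<in> T (b - 1)"
  shows "glue b L U \<inter> grid (b - 1) \<times> grid (b - 1) = L" "unshift_rel b (glue b L U) = U"
proof -
  have L_D: "a \<le> 1 \<and> i < b \<and> c \<le> 1 \<and> j < b" if "((a, i), (c, j)) \<in> L" for a i c j
    using grid_T[OF L that] b by auto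
  show "glue b L U \<inter> grid (b - 1) \<times> grid (b - 1) = L"
    using b by (auto simp: glue_iff dest: L_D)
  show "unshift_rel b (glue b L U) = U"
    by (auto simp: glue_iff unshift_rel_iff dest: L_D)
qed

text \<open>As no pair crosses column \<open>b\<close>, stationarity of a column is decided inside
  its own part.\<close>

lemma card_stat_cols_glue:
  assumes b: "0 < b" "b \<le> n" and L: "L \<in> T (b - 1)" and U: "U \<in> T (n - b)"
  shows "card (stat_cols n (glue b L U)) = card (stat_cols (b - 1) L) + card (stat_cols (n - b) U)"
proof -
  have L_D: "i < b \<and> j < b" if "((a, i), (c, j)) \<in> L" for a i c j
    using grid_T[OF L that] b by auto
  have "stat_cols n (glue b L U) = stat_cols (b - 1) L \<union> (\<lambda>c. c + b) ` stat_cols (n - b) U"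
  proof (intro set_eqI)
    fix q
    show "q \<in> stat_cols n (glue b L U) \<longleftrightarrow> q \<in> stat_cols (b - 1) L \<union> (\<lambda>c. c + b) ` stat_cols (n - b) U"
    proof (cases "q < b")
      case True
      then have "q \<notin> (\<lambda>c. c + b) ` stat_cols (n - b) U" by auto
      with True b show ?thesis
        by (auto simp: stat_cols_def glue_iff)
    next
      case False
      then obtain p where p: "q = p + b" by (metis add.commute le_Suc_ex not_less)
      have "(\<exists>c d. q < d \<and> c \<le> q \<and> ((1, c), (1, d)) \<in> glue b L U) \<longleftrightarrow>
          (\<exists>c d. p < d \<and> c \<le> p \<and> ((1, c), (1, d)) \<in> U)" (is "?l \<longleftrightarrow> ?r")
      proof
        assume ?l
        then obtain c d where "q < d" "c \<le> q" "((1, c), (1, d)) \<in> glue b L U" by blast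
        with p show ?r
          by (intro exI[of _ "c - b"] exI[of _ "d - b"]) (auto simp: glue_iff dest: L_D)
      next
        assume ?r
        then obtain c d where "p < d" "c \<le> p" "((1, c), (1, d)) \<in> U" by blast
        with p show ?l
          by (intro exI[of _ "c + b"] exI[of _ "d + b"]) (auto simp: glue_iff)
      qed
      moreover have "q \<in> stat_cols (b - 1) L \<union> (\<lambda>c. c + b) ` stat_cols (n - b) U \<longleftrightarrow> p \<in> stat_cols (n - b) U"
      proof -
        have "q \<notin> stat_cols (b - 1) L"
          using False b by (auto simp: stat_cols_def)
        with p show ?thesis by auto
      qed
      ultimately show ?thesis
        using p b by (auto simp: stat_cols_def)
    qed
  qed
  moreover have "stat_cols (b - 1) L \<inter> (\<lambda>c. c + b) ` stat_cols (n - b) U = {}"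
    using b by (auto simp: stat_cols_def)
  ultimately show ?thesis
    by (simp add: card_Un_disjoint card_image inj_on_def)
qed

text \<open>The target \<open>(0, n)\<close> lies in the upper part, so only columns of that part
  can be extendable.\<close>

lemma card_ext_cols_glue:
  assumes b: "0 < b" "b \<le> n" and L: "L \<in> T (b - 1)"
  shows "card (ext_cols n (glue b L U)) = card (ext_cols (n - b) U)"
proof -
  have L_D: "i < b \<and> j < b" if "((a, i), (c, j)) \<in> L" for a i c j
    using grid_T[OF L that] b by auto
  have "ext_cols n (glue b L U) = (\<lambda>c. c + b) ` ext_cols (n - b) U"
  proof (intro set_eqI iffI)
    fix q assume "q \<in> ext_cols n (glue b L U)"
    with b have "b \<le> q" "q - b \<in> ext_cols (n - b) U"
      by (auto simp: ext_cols_def glue_iff dest: L_D)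
    then show "q \<in> (\<lambda>c. c + b) ` ext_cols (n - b) U"
      by (intro image_eqI[of _ _ "q - b"]) auto
  qed (use b in \<open>auto simp: ext_cols_def glue_iff\<close>)
  then show ?thesis
    by (simp add: card_image inj_on_def)
qed

lemma minimal_fibrant_glue:
  assumes b: "0 < b" "b \<le> n" and L: "L \<in> T (b - 1)"
  shows "minimal_fibrant n (glue b L U) (0, b) \<longleftrightarrow> minimal_fibrant (n - b) U (0, 0)"
proof -
  have L_D: "i < b \<and> j < b" if "((a, i), (c, j)) \<in> L" for a i c j
    using grid_T[OF L that] b by auto
  show ?thesis
    using b by (auto simp: minimal_fibrant_0 glue_iff dest: L_D)
qed

text \<open>Gluing is a bijection from pairs \<open>(L, U)\<close>. Stationary elements add up, with
  \<open>i\<close> the share of \<open>L\<close>, while all extendable elements come from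
  \<open>U\<close>.\<close>

lemma card_fib_0:
  assumes b: "0 < b" "b \<le> n"
  shows "card (T_stat_ext_fib n k l (0, b)) =
    (\<Sum>i = 0..k. card (Tam_stat (b-1) i) * card (T_stat_ext_fib (n-b) (k-i) l (0, 0)))"
proof -
  let ?B = "T_stat_ext_fib n k l (0, b)"
  let ?A = "\<Union>i\<in>{0..k}. Tam_stat (b-1) i \<times> T_stat_ext_fib (n-b) (k-i) l (0, 0)"
  \<comment> \<open>Since \<open>i \<le> k\<close>, the subtraction \<open>k - i\<close> is exact,
    and the union over \<open>i\<close> amounts to one equation for the sum.\<close>
  have A: "(L, U) \<in> ?A \<longleftrightarrow> L \<in> Tam (b-1) \<and> U \<in> T (n-b)
      \<and> card (stat_cols (b-1) L) + card (stat_cols (n-b) U) = k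
      \<and> card (ext_cols (n-b) U) = l \<and> minimal_fibrant (n-b) U (0, 0)" for L U
    by (auto simp: counting_defs)
  have B: "R \<in> ?B \<longleftrightarrow> R \<in> T n \<and> card (stat_cols n R) = k \<and> card (ext_cols n R) = l
      \<and> minimal_fibrant n R (0, b)" for R
    by (auto simp: counting_defs)
  have LT: "L \<in> T (b-1)" if "(L, U) \<in> ?A" for L U
    using that A Tam_def by blast
  have inj: "inj_on (\<lambda>(L, U). glue b L U) ?A"
  proof (rule inj_onI, clarify)
    fix i i' L U L' U'
    assume eq: "glue b L U = glue b L' U'" and "L \<in> Tam_stat (b-1) i" "L' \<in> Tam_stat (b-1) i'"
    then have "L \<in> T (b-1)" "L' \<in> T (b-1)"
      by (auto simp: Tam_stat_def Tam_def)
    with eq show "L = L' \<and> U = U'"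
      using glue_parts[OF b(1)] by metis
  qed
  have img: "(\<lambda>(L, U). glue b L U) ` ?A = ?B"
  proof (intro equalityI subsetI)
    fix R assume "R \<in> (\<lambda>(L, U). glue b L U) ` ?A"
    then obtain L U where LU: "(L, U) \<in> ?A" and R: "R = glue b L U" by blast
    with A have "L \<in> Tam (b-1)" "U \<in> T (n-b)" by blast+
    with LU show "R \<in> ?B"
      unfolding A B R using LT[OF LU]
      by (simp add: glue_T[OF b] card_stat_cols_glue[OF b] card_ext_cols_glue[OF b]
          minimal_fibrant_glue[OF b])
  next
    fix R assume R: "R \<in> ?B"
    let ?L = "R \<inter> grid (b-1) \<times> grid (b-1)" and ?U = "unshift_rel b R"
    have RT: "R \<in> T n" and fib: "minimal_fibrant n R (0, b)"
      using R B by blast+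
    have L: "?L \<in> Tam (b-1)"
      using fib by (intro lower_Tam[OF RT b]) (simp add: minimal_fibrant_0)
    then have LT: "?L \<in> T (b-1)" by (simp add: Tam_def)
    have U: "?U \<in> T (n-b)" by (rule unshift_rel_T[OF RT b(2)])
    have eq: "R = glue b ?L ?U" by (rule eq_glue[OF RT b fib])
    have "card (stat_cols (b-1) ?L) + card (stat_cols (n-b) ?U) = k"
      using R B card_stat_cols_glue[OF b LT U] eq by metis
    moreover have "card (ext_cols (n-b) ?U) = l"
      using R B card_ext_cols_glue[OF b LT] eq by metis
    moreover have "minimal_fibrant (n-b) ?U (0, 0)"
      using fib minimal_fibrant_glue[OF b LT] eq by metis
    ultimately have "(?L, ?U) \<in> ?A"
      unfolding A using L U by blast
    then show "R \<in> (\<lambda>(L, U). glue b L U) ` ?A"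
      using eq by (intro image_eqI[of _ _ "(?L, ?U)"]) simp
  qed
  have "card ?B = card ?A"
    using card_image[OF inj] unfolding img .
  also have "\<dots> = (\<Sum>i = 0..k. card (Tam_stat (b-1) i \<times> T_stat_ext_fib (n-b) (k-i) l (0, 0)))"
    by (rule card_UN_disjoint) (auto simp: counting_defs finite_T)
  finally show ?thesis
    by (simp add: card_cartesian_product)
qed

section \<open>Duality\<close>

text \<open>An order-reversing involution on the grid only: off the grid, subtraction
  truncates.\<close>

definition flip :: "nat \<Rightarrow> nat \<times> nat \<Rightarrow> nat \<times> nat" where
  "flip n x = (1 - fst x, n - snd x)"

text \<open>The left lifting property against \<open>R\<close>: in a poset a square consists of
  \<open>x \<le> u\<close> and \<open>y \<le> v\<close>, and a lift is
  \<open>y \<le> u\<close>.\<close>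

definition left_class :: "nat \<Rightarrow> (nat \<times> nat) rel \<Rightarrow> (nat \<times> nat) rel" where
  "left_class n R = {(x, y). x \<in> grid n \<and> y \<in> grid n \<and> x \<le> y \<and>
     (\<forall>u v. (u, v) \<in> R \<longrightarrow> x \<le> u \<longrightarrow> y \<le> v \<longrightarrow> y \<le> u)}"

definition dual :: "nat \<Rightarrow> (nat \<times> nat) rel \<Rightarrow> (nat \<times> nat) rel" where
  "dual n R = {(x, y). x \<in> grid n \<and> y \<in> grid n \<and> (flip n y, flip n x) \<in> left_class n R}"

lemma left_classI:
  assumes "x \<in> grid n" "y \<in> grid n" "x \<le> y"
    and "\<And>u v. (u, v) \<in> R \<Longrightarrow> x \<le> u \<Longrightarrow> y \<le> v \<Longrightarrow> y \<le> u"
  shows "(x, y) \<in> left_class n R"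
  using assms unfolding left_class_def by blast

lemma left_class_grid: "(x, y) \<in> left_class n R \<Longrightarrow> x \<in> grid n \<and> y \<in> grid n \<and> x \<le> y"
  unfolding left_class_def by blast

lemma left_classD:
  "(x, y) \<in> left_class n R \<Longrightarrow> (u, v) \<in> R \<Longrightarrow> x \<le> u \<Longrightarrow> y \<le> v \<Longrightarrow> y \<le> u"
  unfolding left_class_def by blast

lemma dual_iff:
  "(x, y) \<in> dual n R \<longleftrightarrow> x \<in> grid n \<and> y \<in> grid n \<and> (flip n y, flip n x) \<in> left_class n R"
  unfolding dual_def by blast

lemma flip_Pair [simp]: "flip n (a, i) = (1 - a, n - i)"
  by (simp add: flip_def)

lemma flip_grid [simp]: "flip n x \<in> grid n"
  by (cases x) simp

lemma flip_flip [simp]: "x \<in> grid n \<Longrightarrow> flip n (flip n x) = x"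
  by (cases x) auto

lemma flip_le_iff [simp]: "x \<in> grid n \<Longrightarrow> y \<in> grid n \<Longrightarrow> flip n x \<le> flip n y \<longleftrightarrow> y \<le> x"
  by (cases x; cases y) auto

lemma flip_le_swap: "x \<in> grid n \<Longrightarrow> y \<in> grid n \<Longrightarrow> flip n x \<le> y \<longleftrightarrow> flip n y \<le> x"
  by (metis flip_flip flip_grid flip_le_iff)

lemma flip_inf:
  "x \<in> grid n \<Longrightarrow> y \<in> grid n \<Longrightarrow> flip n (inf x y) = sup (flip n x) (flip n y)"
  by (cases x; cases y) (auto simp: inf_prod_def sup_prod_def inf_nat_def sup_nat_def)

lemma inf_grid: "x \<in> grid n \<Longrightarrow> y \<in> grid n \<Longrightarrow> inf x y \<in> grid n"
  by (cases x; cases y) (auto simp: inf_prod_def inf_nat_def)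

text \<open>A left lifting class contains identities and is closed under composition and under
  cobase change, which is a join here. \<open>flip\<close> turns the join into the meet of the
  restriction axiom.\<close>

lemma dual_T: "dual n R \<in> T n"
proof (rule T_I)
  fix x y z :: "nat \<times> nat"
  show "x \<in> grid n \<and> y \<in> grid n \<and> x \<le> y" if "(x, y) \<in> dual n R"
    using that left_class_grid[of "flip n y" "flip n x" n R] by (simp add: dual_iff)
  show "(x, x) \<in> dual n R" if "x \<in> grid n"
    using that by (auto simp: dual_iff intro: left_classI)
  show "(x, z) \<in> dual n R" if xy: "(x, y) \<in> dual n R" and yz: "(y, z) \<in> dual n R"
  proof -
    have g: "x \<in> grid n" "y \<in> grid n" "z \<in> grid n"
      and l: "(flip n z, flip n y) \<in> left_class n R" "(flip n y, flip n x) \<in> left_class n R"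
      using xy yz by (auto simp: dual_iff)
    have le: "flip n z \<le> flip n y" "flip n y \<le> flip n x"
      using l[THEN left_class_grid] by auto
    have "(flip n z, flip n x) \<in> left_class n R"
    proof (rule left_classI)
      fix u v assume uv: "(u, v) \<in> R" "flip n z \<le> u" "flip n x \<le> v"
      then have "flip n y \<le> u"
        using left_classD[OF l(1) uv(1,2)] le(2) by (meson order_trans)
      then show "flip n x \<le> u"
        using left_classD[OF l(2) uv(1)] uv(3) by blast
    qed (use le in \<open>auto intro: order_trans\<close>)
    with g show ?thesis by (simp add: dual_iff)
  qed
  show "(inf x z, z) \<in> dual n R" if xy: "(x, y) \<in> dual n R" and z: "z \<in> grid n" "z \<le> y"
  proof -
    have g: "x \<in> grid n" "y \<in> grid n" and lift: "(flip n y, flip n x) \<in> left_class n R"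
      using xy by (auto simp: dual_iff)
    have le: "flip n y \<le> flip n z"
      using z g by simp
    have "(flip n z, flip n (inf x z)) \<in> left_class n R"
    proof (rule left_classI)
      fix u v assume uv: "(u, v) \<in> R" "flip n z \<le> u" "flip n (inf x z) \<le> v"
      \<comment> \<open>As a join, \<open>flip n (inf x z)\<close> lies below an element exactly
        when both \<open>flip n x\<close> and \<open>flip n z\<close> do.\<close>
      then have "flip n x \<le> v"
        using g z by (simp add: flip_inf)
      moreover have "flip n y \<le> u"
        using le uv(2) by (rule order_trans)
      ultimately have "flip n x \<le> u"
        using left_classD[OF lift uv(1)] by blast
      with uv(2) show "flip n (inf x z) \<le> u"
        using g z by (simp add: flip_inf)
    qed (use g z in \<open>simp_all add: inf_grid\<close>)
    then show ?thesis
      using g z by (simp add: dual_iff inf_grid)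
  qed
qed

text \<open>The middle point is a minimal \<open>z\<close> above \<open>x\<close> with
  \<open>(z, y) \<in> R\<close>.\<close>

lemma factorization:
  assumes R: "R \<in> T n" and g: "x \<in> grid n" "y \<in> grid n" and le: "x \<le> y"
  obtains z where "(x, z) \<in> left_class n R" "(z, y) \<in> R"
proof -
  let ?Z = "{z. (z, y) \<in> R \<and> x \<le> z}"
  have "?Z \<subseteq> grid n"
    using grid_T[OF R] by blast
  then have "finite ?Z"
    by (rule finite_subset) simp
  moreover have "y \<in> ?Z"
    using refl_T[OF R g(2)] le by blast
  ultimately obtain z where z: "z \<in> ?Z" and min: "\<And>w. w \<in> ?Z \<Longrightarrow> w \<le> z \<Longrightarrow> z = w"
    using finite_has_minimal[of ?Z] by blast
  have zg: "z \<in> grid n" using z grid_T[OF R] by blast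
  have "(x, z) \<in> left_class n R"
  proof (rule left_classI)
    fix u v assume uv: "(u, v) \<in> R" "x \<le> u" "z \<le> v"
    \<comment> \<open>Restricting \<open>(u, v)\<close> to \<open>z\<close> makes
      \<open>inf u z\<close> another candidate below \<open>z\<close>, so minimality forces
      equality, and this is the lift.\<close>
    have "(inf u z, z) \<in> R"
      using restrict_T[OF R uv(1) zg uv(3)] .
    with z have "(inf u z, y) \<in> R"
      using trans_T[OF R] by blast
    with z uv(2) have "inf u z \<in> ?Z"
      by simp
    with min have "z = inf u z" by simp
    then show "z \<le> u" by (metis inf.cobounded1)
  qed (use z zg g in auto)
  with z show thesis
    by (intro that) auto
qed

text \<open>The double dual consists of the pairs with the right lifting property against the left
  class of \<open>R\<close>. Pairs of \<open>R\<close> have it by definition; the converse is the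
  retract argument.\<close>

lemma dual_dual:
  assumes R: "R \<in> T n"
  shows "dual n (dual n R) = R"
proof (intro equalityI subrelI)
  fix x y assume xy: "(x, y) \<in> R"
  have g: "x \<in> grid n" "y \<in> grid n" "x \<le> y"
    using grid_T[OF R xy] le_T[OF R xy] by auto
  have "(flip n y, flip n x) \<in> left_class n (dual n R)"
  proof (rule left_classI)
    fix u v assume uv: "(u, v) \<in> dual n R" and le: "flip n y \<le> u" "flip n x \<le> v"
    have gr: "u \<in> grid n" "v \<in> grid n" and lift: "(flip n v, flip n u) \<in> left_class n R"
      using uv by (auto simp: dual_iff)
    have "flip n v \<le> x" "flip n u \<le> y"
      using le g gr flip_le_swap by metis+
    with lift xy have "flip n u \<le> x"
      by (rule left_classD)
    then show "flip n x \<le> u"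
      using g gr flip_le_swap by metis
  qed (use g in auto)
  with g show "(x, y) \<in> dual n (dual n R)"
    by (simp add: dual_iff)
next
  fix x y assume "(x, y) \<in> dual n (dual n R)"
  then have g: "x \<in> grid n" "y \<in> grid n"
    and lift: "(flip n y, flip n x) \<in> left_class n (dual n R)"
    by (auto simp: dual_iff)
  have "x \<le> y"
    using left_class_grid[OF lift] g by simp
  with g obtain z where z: "(x, z) \<in> left_class n R" "(z, y) \<in> R"
    using factorization[OF R] by blast
  have zg: "z \<in> grid n" "x \<le> z" "z \<le> y"
    using left_class_grid[OF z(1)] le_T[OF R z(2)] by auto
  \<comment> \<open>Lifting the left factor \<open>(x, z)\<close> against \<open>(x, y)\<close>
    gives \<open>z \<le> x\<close>, so the factorization is trivial.\<close>
  have "(flip n z, flip n x) \<in> dual n R"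
    using z(1) zg g by (simp add: dual_iff)
  from left_classD[OF lift this] have "flip n x \<le> flip n z"
    using zg g by simp
  then have "z = x" using zg g by simp
  with z show "(x, y) \<in> R" by simp
qed

text \<open>Extendability of \<open>(0, n - Suc b)\<close> in the dual says that the pair from
  \<open>(1, 0)\<close> to \<open>(1, Suc b)\<close> lifts against \<open>R\<close>, that is, no
  pair of \<open>R\<close> in row 1 jumps from a column up to \<open>b\<close> to one beyond
  it.\<close>

lemma card_ext_cols_dual:
  assumes R: "R \<in> T n"
  shows "card (ext_cols n (dual n R)) = card (stat_cols n R)"
proof -
  have R_D: "a \<le> c \<and> i \<le> j \<and> c \<le> 1 \<and> j \<le> n" if "((a, i), (c, j)) \<in> R" for a i c j
    using grid_T[OF R that] le_T[OF R that] by auto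
  have "((0, n - Suc b), (0, n)) \<in> dual n R \<longleftrightarrow> b \<in> stat_cols n R" if b: "b < n" for b
  proof -
    have "((0, n - Suc b), (0, n)) \<in> dual n R \<longleftrightarrow> ((1, 0), (1, Suc b)) \<in> left_class n R"
      using b by (simp add: dual_iff Suc_diff_Suc)
    also have "\<dots> \<longleftrightarrow> (\<forall>c d. ((1, c), (1, d)) \<in> R \<longrightarrow> Suc b \<le> d \<longrightarrow> Suc b \<le> c)"
      (is "?l \<longleftrightarrow> ?r")
    proof
      assume l: ?l
      show ?r
      proof (intro allI impI)
        fix c d assume "((1, c), (1, d)) \<in> R" "Suc b \<le> d"
        then show "Suc b \<le> c"
          using left_classD[OF l, of "(1, c)" "(1, d)"] by simp
      qed
    next
      assume r: ?r
      show ?l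
      proof (rule left_classI)
        fix u v assume uv: "(u, v) \<in> R" "(1, 0) \<le> u" "(1, Suc b) \<le> v"
        then obtain c d where "u = (1, c)" "v = (1, d)"
          using grid_T[OF R uv(1)] by (cases u; cases v) auto
        with r uv show "(1, Suc b) \<le> u" by simp
      qed (use b in auto)
    qed
    also have "\<dots> \<longleftrightarrow> b \<in> stat_cols n R"
      using b by (simp add: stat_cols_def Suc_le_eq) (metis not_le)
    finally show ?thesis .
  qed
  then have *: "n - Suc b \<in> ext_cols n (dual n R) \<longleftrightarrow> b \<in> stat_cols n R" if "b < n" for b
    using that by (simp add: ext_cols_def)
  have lt: "b < n" if "b \<in> stat_cols n R - {n} \<or> b \<in> ext_cols n (dual n R) - {n}" for b
    using that by (auto simp: stat_cols_def ext_cols_def)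
  have inv: "n - Suc (n - Suc b) = b" if "b \<in> stat_cols n R - {n} \<or> b \<in> ext_cols n (dual n R) - {n}" for b
    using lt[OF that] by simp
  \<comment> \<open>The reflection is an involution only on the columns below \<open>n\<close>;
    column \<open>n\<close> belongs to both sets and is set aside.\<close>
  have "bij_betw (\<lambda>b. n - Suc b) (stat_cols n R - {n}) (ext_cols n (dual n R) - {n})"
  proof (rule bij_betw_byWitness[where f' = "\<lambda>b. n - Suc b"])
    have "n - Suc b \<in> ext_cols n (dual n R) - {n}" if "b \<in> stat_cols n R - {n}" for b
      using that *[of b] lt[of b] by auto
    then show "(\<lambda>b. n - Suc b) ` (stat_cols n R - {n}) \<subseteq> ext_cols n (dual n R) - {n}"
      by (rule image_subsetI)
    have "n - Suc b \<in> stat_cols n R - {n}" if "b \<in> ext_cols n (dual n R) - {n}" for b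
    proof -
      have b: "b \<in> ext_cols n (dual n R)" "b < n"
        using that lt by auto
      then have "n - Suc (n - Suc b) = b" "n - Suc b < n"
        by auto
      with b *[of "n - Suc b"] show ?thesis by simp
    qed
    then show "(\<lambda>b. n - Suc b) ` (ext_cols n (dual n R) - {n}) \<subseteq> stat_cols n R - {n}"
      by (rule image_subsetI)
  qed (intro ballI inv; blast)+
  then have "card (stat_cols n R - {n}) = card (ext_cols n (dual n R) - {n})"
    by (rule bij_betw_same_card)
  moreover have "n \<in> stat_cols n R"
    by (auto simp: stat_cols_def dest: R_D)
  moreover have "n \<in> ext_cols n (dual n R)"
    using refl_T[OF dual_T] by (simp add: ext_cols_def)
  ultimately show ?thesis
    by (metis card.remove finite_cols)
qed

text \<open>\<open>m\<close> is also the largest element to which \<open>(0, 0)\<close> is related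
  in the left class; flipping exchanges the two descriptions.\<close>

lemma minimal_fibrant_dual:
  assumes R: "R \<in> T n" and m: "minimal_fibrant n R m"
  shows "minimal_fibrant n (dual n R) (flip n m)"
proof -
  have m1: "(m, (1, n)) \<in> R" and min: "\<And>w. (w, (1, n)) \<in> R \<Longrightarrow> \<not> w < m"
    using m by (auto simp: minimal_fibrant_def fibrant_def)
  have g: "m \<in> grid n" using grid_T[OF R m1] by blast
  obtain z where z: "((0, 0), z) \<in> left_class n R" "(z, (1, n)) \<in> R"
    using factorization[OF R, of "(0, 0)" "(1, n)"] by auto
  \<comment> \<open>The left factor lifts against \<open>(m, (1, n))\<close>; as \<open>z\<close> is
    fibrant, minimality of \<open>m\<close> then gives equality.\<close>
  have "z \<le> m"
    using left_classD[OF z(1) m1] grid_T[OF R z(2)] by (cases m; cases z) auto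
  with min[OF z(2)] have "z = m" by (simp add: less_le)
  with z have "((0, 0), m) \<in> left_class n R" by simp
  then have fib: "fibrant n (dual n R) (flip n m)"
    using g by (simp add: fibrant_def dual_iff)
  have "\<not> y < flip n m" if "fibrant n (dual n R) y" for y
  proof -
    have y: "y \<in> grid n" "((0, 0), flip n y) \<in> left_class n R"
      using that by (auto simp: fibrant_def dual_iff)
    then have "flip n y \<le> m"
      using left_classD[OF y(2) m1] by (cases m; cases y) auto
    then have "flip n m \<le> y"
      using y g by (metis flip_flip flip_grid flip_le_iff)
    then show ?thesis by (simp add: less_le_not_le)
  qed
  with fib show ?thesis
    by (auto simp: minimal_fibrant_def)
qed

lemma card_fib_flip:
  assumes m: "m \<in> grid n"
  shows "card (T_stat_ext_fib n k l m) = card (T_stat_ext_fib n l k (flip n m))"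
proof -
  \<comment> \<open>Stated for arbitrary indices, so that it also covers the inverse map.\<close>
  have "dual n R \<in> T_stat_ext_fib n l k (flip n m)" if "R \<in> T_stat_ext_fib n k l m" for R k l m
  proof -
    have R: "R \<in> T n" using that by (simp add: counting_defs)
    \<comment> \<open>The count for the dual, applied to \<open>dual n R\<close>, gives the other
      half of the exchange.\<close>
    have "card (stat_cols n (dual n R)) = card (ext_cols n R)"
      using card_ext_cols_dual[OF dual_T, of n R] dual_dual[OF R] by simp
    then show ?thesis
      using that dual_T card_ext_cols_dual[OF R] minimal_fibrant_dual[OF R] by (simp add: counting_defs)
  qed
  from this[of _ k l m] this[of _ l k "flip n m"]
  have "bij_betw (dual n) (T_stat_ext_fib n k l m) (T_stat_ext_fib n l k (flip n m))"
    using m by (intro bij_betw_byWitness[where f' = "dual n"])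
      (auto simp: dual_dual counting_defs simp del: grid_iff)
  then show ?thesis
    by (rule bij_betw_same_card)
qed

section \<open>Partition by the two counts and the minimal fibrant element\<close>

lemma card_T_partition:
  "card (T n) = (\<Sum>k = 1..n+1. \<Sum>l = 1..n+1. \<Sum>x\<in>grid n. card (T_stat_ext_fib n k l x))"
proof -
  let ?I = "{1..n+1} \<times> {1..n+1} \<times> grid n"
  have "R \<in> (\<Union>(k, l, x)\<in>?I. T_stat_ext_fib n k l x)" if R: "R \<in> T n" for R
  proof -
    define k l where "k = card (stat_cols n R)" and "l = card (ext_cols n R)"
    have kl: "R \<in> T_stat_ext n k l"
      using R by (simp add: counting_defs k_def l_def)
    obtain x where x: "minimal_fibrant n R x"
      using ex1_minimal_fibrant[OF R] by blast
    then have "x \<in> grid n"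
      using grid_T[OF R] unfolding minimal_fibrant_def fibrant_def by blast
    \<comment> \<open>The pieces cover \<open>T n\<close> because no count leaves the summation
      range.\<close>
    moreover have "k \<in> {1..n+1}" "l \<in> {1..n+1}"
      using T_stat_ext_out_of_range[of k n l] kl by blast+
    ultimately show ?thesis
      using kl x by (intro UN_I[of "(k, l, x)"]) (simp_all add: T_stat_ext_fib_def)
  qed
  then have "T n = (\<Union>(k, l, x)\<in>?I. T_stat_ext_fib n k l x)"
    by (auto simp: T_stat_ext_fib_def T_stat_ext_def)
  then have "card (T n) = card (\<Union>p\<in>?I. case p of (k, l, x) \<Rightarrow> T_stat_ext_fib n k l x)"
    by simp
  also have "\<dots> = (\<Sum>(k, l, x)\<in>?I. card (T_stat_ext_fib n k l x))"
  proof (subst card_UN_disjoint)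
    show "\<forall>p\<in>?I. \<forall>q\<in>?I. p \<noteq> q \<longrightarrow>
        (case p of (k, l, x) \<Rightarrow> T_stat_ext_fib n k l x) \<inter>
        (case q of (k, l, x) \<Rightarrow> T_stat_ext_fib n k l x) = {}"
    proof (intro ballI impI equals0I)
      fix p q R
      assume "p \<noteq> q" and R: "R \<in> (case p of (k, l, x) \<Rightarrow> T_stat_ext_fib n k l x) \<inter>
        (case q of (k, l, x) \<Rightarrow> T_stat_ext_fib n k l x)"
      obtain k l x k' l' x' where [simp]: "p = (k, l, x)" "q = (k', l', x')"
        by (cases p; cases q) auto
      \<comment> \<open>The counts determine \<open>k\<close> and \<open>l\<close>, so distinct
        indices must differ in \<open>x\<close>, against uniqueness of the minimal fibrant
        element.\<close>
      from R have "R \<in> T n" "minimal_fibrant n R x" "minimal_fibrant n R x'" "k = k'" "l = l'"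
        by (auto simp: T_stat_ext_fib_def T_stat_ext_def)
      with \<open>p \<noteq> q\<close> show False
        using ex1_minimal_fibrant by (auto simp del: split_paired_Ex)
    qed
  qed (auto simp: T_stat_ext_fib_def T_stat_ext_def finite_T split_def)
  also have "\<dots> = (\<Sum>k = 1..n+1. \<Sum>l = 1..n+1. \<Sum>x\<in>grid n. card (T_stat_ext_fib n k l x))"
    by (simp add: sum.cartesian_product)
  finally show ?thesis .
qed

theorem theorem4p3:
  fixes n :: nat
  shows "(\<forall>k\<in>{1..n+1}. \<forall>l\<in>{1..n+1}.
            (n \<ge> 1 \<longrightarrow>
               card (T_stat_ext_fib n k l (0, 0)) =
               (\<Sum>k' = k-1..n. card (T_stat_ext (n-1) k' (l-1)))) \<and>
            (\<forall>b. 0 < b \<and> b \<le> n \<longrightarrow>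
               card (T_stat_ext_fib n k l (0, b)) =
               (\<Sum>i = 0..k. card (Tam_stat (b-1) i) * card (T_stat_ext_fib (n-b) (k-i) l (0, 0)))) \<and>
            (\<forall>b. 0 \<le> b \<and> b \<le> n \<longrightarrow>
               card (T_stat_ext_fib n k l (1, b)) = card (T_stat_ext_fib n l k (0, n-b)))) \<and>
         card (T n) =
         (\<Sum>k = 1..n+1. \<Sum>l = 1..n+1. \<Sum>x\<in>grid n. card (T_stat_ext_fib n k l x))"
proof -
  have "card (T_stat_ext_fib n k l (1, b)) = card (T_stat_ext_fib n l k (0, n-b))" if "b \<le> n" for k l b
    using card_fib_flip[of "(1, b)" n k l] that by simp
  then show ?thesis
    using card_fib_00 card_fib_0 card_T_partition by (auto simp del: sum.cl_ivl_Suc)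
qed

end
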